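(* Let $\Phi=(G,\mathbb{T},\varphi)$ be a complex unit gain graph whose underlying graph $G$ is connected. Then $$2m(G)-2c(G)\le r(G,\varphi)\le 2m(G)+c(G).$$
   Context: $G=(V,E)$ is a simple graph with $V=\{v_1,\dots,v_n\}$; $e_{i,j}$ denotes the ordered pair $(v_i,v_j)$ for $v_iv_j\in E$, and $\overrightarrow{E}=\{e_{i,j},e_{j,i}: v_iv_j\in E\}$. $\mathbb{T}=\{z\in\mathbb{C}:|z|=1\}$. A complex unit gain graph $(G,\varphi)$ is $G$ together with a map $\varphi:\overrightarrow{E}\to\mathbb{T}$ with $\varphi(e_{i,j})=\varphi(e_{j,i})^{-1}$. Its adjacency matrix is the $n\times n$ Hermitian matrix $H(G,\varphi)=(a_{i,j})$ with $a_{i,j}=\varphi(e_{i,j})$ if $v_iv_j\in E$ and $a_{i,j}=0$ otherwise; $r(G,\varphi)$ is the rank of $H(G,\varphi)$. $m(G)$ is the matching number of $G$, and $c(G)=|E(G)|-|V(G)|+\omega(G)$ is the cyclomatic number, where $\omega(G)$ is the number of connected components. *)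

theory Defs
  imports
    Complex_Main
    "Graph_Theory.Pair_Digraph"
    "Graph_Theory.Digraph_Component"
    "Jordan_Normal_Form.DL_Rank"
begin

text \<open>
  A simple graph is a \<open>pair_graph\<close>: a finite, loop-free, symmetric digraph whose arcs are
  ordered pairs of vertices. Hence \<open>parcs G\<close> is the set of the oriented edges, in which each
  undirected edge occurs once in each direction.
\<close>

definition edges :: "'a pair_pre_digraph \<Rightarrow> 'a set set" where
  "edges G = (\<lambda>(u, v). {u, v}) ` parcs G"

text \<open>In a symmetric digraph the strongly connected components are the connected components.\<close>

definition num_components :: "'a pair_pre_digraph \<Rightarrow> nat" where
  "num_components G = card (pre_digraph.sccs (with_proj G))"

definition cyclomatic_number :: "'a pair_pre_digraph \<Rightarrow> int" where
  "cyclomatic_number G = int (card (edges G)) - int (card (pverts G)) + int (num_components G)"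

definition is_matching :: "'a pair_pre_digraph \<Rightarrow> 'a set set \<Rightarrow> bool" where
  "is_matching G M \<longleftrightarrow> M \<subseteq> edges G \<and> pairwise disjnt M"

definition matching_number :: "'a pair_pre_digraph \<Rightarrow> nat" where
  "matching_number G = Max (card ` {M. is_matching G M})"

definition unit_complex :: "complex set" where
  "unit_complex = {z. cmod z = 1}"

locale complex_unit_gain_graph = pair_graph G
  for G :: "'a pair_pre_digraph" +
  fixes \<phi> :: "'a \<times> 'a \<Rightarrow> complex"
  assumes gain_unit: "e \<in> parcs G \<Longrightarrow> \<phi> e \<in> unit_complex"
    and gain_inverse: "(u, v) \<in> parcs G \<Longrightarrow> \<phi> (u, v) = inverse (\<phi> (v, u))"

text \<open>The list \<open>vs\<close> is the enumeration of the vertices that indexes the rows and columns.\<close>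

definition gain_adjacency_matrix ::
    "'a pair_pre_digraph \<Rightarrow> ('a \<times> 'a \<Rightarrow> complex) \<Rightarrow> 'a list \<Rightarrow> complex mat" where
  "gain_adjacency_matrix G \<phi> vs = mat (length vs) (length vs)
     (\<lambda>(i, j). if (vs ! i, vs ! j) \<in> parcs G then \<phi> (vs ! i, vs ! j) else 0)"

definition gain_rank ::
    "'a pair_pre_digraph \<Rightarrow> ('a \<times> 'a \<Rightarrow> complex) \<Rightarrow> 'a list \<Rightarrow> nat" where
  "gain_rank G \<phi> vs = vec_space.rank (length vs) (gain_adjacency_matrix G \<phi> vs)"

end

theory Submission
  imports Defs
begin

text \<open>
  Let \<open>F\<close> be the set of the \<open>c(G)\<close> edges outside a spanning tree.

  Upper bound: \<open>r\<close> independent columns admit an injection \<open>f\<close> from columns to rows with nonzero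
  entries, that is, \<open>r\<close> distinct vertices \<open>v\<close> with edges \<open>v f(v)\<close>. A start of an \<open>f\<close>-path or a
  2-cycle yields a matching edge at the expense of two vertices. If only longer cycles remain,
  some \<open>v f(v)\<close> belongs to \<open>F\<close>, and dropping \<open>v\<close> costs one vertex and one edge of \<open>F\<close>.

  Lower bound: deleting an end of an edge of \<open>F\<close> decreases the matching number by at most one and
  does not increase the rank. Once \<open>F\<close> is exhausted, deleting a leaf together with its neighbour
  decreases the rank by two and the matching number by at most one.
\<close>

subsection \<open>Independent columns\<close>

text \<open>Index sets replace matrices, so that rows and columns can be vertices and deleting a
  vertex only shrinks a set. Coefficients belong to indices: equal columns at different indices are
  dependent.\<close>

definition independent_columns :: "'i set \<Rightarrow> 'j set \<Rightarrow> ('i \<Rightarrow> 'j \<Rightarrow> 'k::field) \<Rightarrow> bool" where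
  "independent_columns I J A \<longleftrightarrow>
    (\<forall>c. (\<forall>i\<in>I. (\<Sum>j\<in>J. A i j * c j) = 0) \<longrightarrow> (\<forall>j\<in>J. c j = 0))"

lemma independent_columnsD:
  assumes "independent_columns I J A" "\<And>i. i \<in> I \<Longrightarrow> (\<Sum>j\<in>J. A i j * c j) = 0" "j \<in> J"
  shows "c j = 0"
  using assms unfolding independent_columns_def by blast

lemma independent_columns_mono:
  assumes "independent_columns I J A" "I \<subseteq> I'"
  shows "independent_columns I' J A"
  using assms unfolding independent_columns_def by blast

text \<open>Carries independence between matrix positions and vertices: the bijection on rows keeps
  the same equations, and injectivity of \<open>g\<close> lets coefficients pass between
  \<open>J\<close> and its image.\<close>

lemma independent_columns_reindex:
  assumes "bij_betw f I' I" "inj_on g J"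
  shows "independent_columns I' J (\<lambda>i j. A (f i) (g j)) \<longleftrightarrow> independent_columns I (g ` J) A"
proof
  assume ind: "independent_columns I' J (\<lambda>i j. A (f i) (g j))"
  show "independent_columns I (g ` J) A"
    unfolding independent_columns_def
  proof (intro allI impI ballI)
    fix c x assume c: "\<forall>i\<in>I. (\<Sum>j\<in>g ` J. A i j * c j) = 0" and "x \<in> g ` J"
    then obtain j where j: "j \<in> J" "x = g j" by blast
    have "(\<Sum>j\<in>J. A (f i) (g j) * c (g j)) = 0" if "i \<in> I'" for i
    proof -
      have "f i \<in> I" using assms(1) that by (auto simp: bij_betw_def)
      then show ?thesis using c by (simp add: sum.reindex[OF assms(2)])
    qed
    then show "c x = 0"
      using independent_columnsD[OF ind, of "\<lambda>j. c (g j)"] j by blast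
  qed
next
  assume ind: "independent_columns I (g ` J) A"
  show "independent_columns I' J (\<lambda>i j. A (f i) (g j))"
    unfolding independent_columns_def
  proof (intro allI impI ballI)
    fix c j assume c: "\<forall>i\<in>I'. (\<Sum>j\<in>J. A (f i) (g j) * c j) = 0" and j: "j \<in> J"
    define d where "d x = c (the_inv_into J g x)" for x
    have d: "d (g j) = c j" if "j \<in> J" for j
      unfolding d_def by (simp add: the_inv_into_f_f[OF assms(2) that])
    have "(\<Sum>x\<in>g ` J. A i x * d x) = 0" if "i \<in> I" for i
    proof -
      have "i \<in> f ` I'" using assms(1) that by (simp add: bij_betw_def)
      then obtain i' where "i' \<in> I'" "i = f i'" by blast
      then show ?thesis using c by (simp add: sum.reindex[OF assms(2)] d)
    qed
    then show "c j = 0"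
      using independent_columnsD[OF ind, of d "g j"] j d by simp
  qed
qed

text \<open>Plays the role of a nonzero term in the expansion of a nonzero minor. Rows are added one
  at a time: if independence fails without row \<open>i\<close>, that row is assigned to a column
  whose removal restores independence on the other rows.\<close>

lemma independent_columns_imp_injection:
  assumes "finite I" "finite J" "independent_columns I J A"
  shows "\<exists>f. inj_on f J \<and> f ` J \<subseteq> I \<and> (\<forall>j\<in>J. A (f j) j \<noteq> 0)"
  using assms
proof (induction I arbitrary: J rule: finite_induct)
  case empty
  have "J = {}"
    using independent_columnsD[OF empty(2), of "\<lambda>_. 1"] by auto
  then show ?case by simp
next
  case (insert i I)
  show ?case
  proof (cases "independent_columns I J A")
    case True
    then show ?thesis using insert.IH[OF insert.prems(1)] by blast
  next
    case False
    then obtain c k where c: "\<And>i. i \<in> I \<Longrightarrow> (\<Sum>j\<in>J. A i j * c j) = 0" and "k \<in> J" "c k \<noteq> 0"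
      unfolding independent_columns_def by blast
    then have s: "(\<Sum>j\<in>J. A i j * c j) \<noteq> 0" (is "?s \<noteq> 0")
      using independent_columnsD[OF insert.prems(2), of c k] by auto
    \<comment> \<open>\<open>A i l\<close> nonzero permits assigning row \<open>i\<close> to column
      \<open>l\<close>; \<open>c l\<close> nonzero makes the removal of \<open>l\<close> destroy the
      relation \<open>c\<close>.\<close>
    obtain l where "l \<in> J" "A i l * c l \<noteq> 0"
      using s by (rule sum.not_neutral_contains_not_neutral)
    then have l: "l \<in> J" "A i l \<noteq> 0" "c l \<noteq> 0" by auto
    have "independent_columns I (J - {l}) A"
      unfolding independent_columns_def
    proof (intro allI impI ballI)
      fix d m assume d: "\<forall>i\<in>I. (\<Sum>j\<in>J - {l}. A i j * d j) = 0" and m: "m \<in> J - {l}"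
      define e where "e = d(l := 0)"
      have sum_e: "(\<Sum>j\<in>J. A i j * e j) = (\<Sum>j\<in>J - {l}. A i j * d j)" for i
      proof -
        have "(\<Sum>j\<in>J. A i j * e j) = A i l * e l + (\<Sum>j\<in>J - {l}. A i j * e j)"
          using insert.prems(1) l(1) by (rule sum.remove)
        also have "(\<Sum>j\<in>J - {l}. A i j * e j) = (\<Sum>j\<in>J - {l}. A i j * d j)"
          by (rule sum.cong) (auto simp: e_def)
        finally show ?thesis by (simp add: e_def)
      qed
      \<comment> \<open>The columns have a one-dimensional kernel on \<open>I\<close>, spanned by \<open>c\<close>, and \<open>c l \<noteq> 0\<close>.\<close>
      define t where "t = (\<Sum>j\<in>J. A i j * e j) / ?s"
      have "(\<Sum>j\<in>J. A i' j * (e j - t * c j)) = 0" if "i' \<in> insert i I" for i'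
      proof -
        have "(\<Sum>j\<in>J. A i' j * (e j - t * c j))
            = (\<Sum>j\<in>J. A i' j * e j) - t * (\<Sum>j\<in>J. A i' j * c j)"
          by (simp add: right_diff_distrib sum_subtractf sum_distrib_left mult.left_commute)
        also have "\<dots> = 0"
          using that c s d by (auto simp: t_def sum_e)
        finally show ?thesis .
      qed
      then have z: "e j - t * c j = 0" if "j \<in> J" for j
        using independent_columnsD[OF insert.prems(2), of "\<lambda>j. e j - t * c j"] that by blast
      have "t = 0" using z[OF l(1)] l(3) by (simp add: e_def)
      then show "d m = 0" using z[of m] m by (simp add: e_def)
    qed
    then obtain f where f: "inj_on f (J - {l})" "f ` (J - {l}) \<subseteq> I" "\<forall>j\<in>J - {l}. A (f j) j \<noteq> 0"
      using insert.IH[of "J - {l}"] insert.prems(1) by blast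
    have "inj_on (f(l := i)) J"
      using f(1,2) insert.hyps(2) l(1) by (auto simp: inj_on_def image_subset_iff)
    moreover have "(f(l := i)) ` J \<subseteq> insert i I" "\<forall>j\<in>J. A ((f(l := i)) j) j \<noteq> 0"
      using f(2,3) l(2) by auto
    ultimately show ?thesis by blast
  qed
qed

section \<open>Matrix rank in terms of independent columns\<close>

context vec_space
begin

lemma lincomb_cols:
  assumes A: "A \<in> carrier_mat n nc" and J: "J \<subseteq> {..<nc}" and inj: "inj_on (col A) J" and i: "i < n"
  shows "lincomb a (col A ` J) $ i = (\<Sum>j\<in>J. A $$ (i, j) * a (col A j))"
proof -
  have "col A ` J \<subseteq> carrier_vec n" using A by auto
  then have "lincomb a (col A ` J) $ i = (\<Sum>x\<in>col A ` J. a x * x $ i)"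
    using i by (simp add: lincomb_index)
  also have "\<dots> = (\<Sum>j\<in>J. a (col A j) * col A j $ i)"
    by (simp add: sum.reindex[OF inj])
  also have "\<dots> = (\<Sum>j\<in>J. A $$ (i, j) * a (col A j))"
    using A J i by (intro sum.cong) (auto simp: mult.commute)
  finally show ?thesis .
qed

lemma set_cols_eq_image: "A \<in> carrier_mat n nc \<Longrightarrow> set (cols A) = col A ` {..<nc}"
  by (auto simp: cols_def)

text \<open>Two equal columns in \<open>J\<close> would give the relation "difference equals zero",
  so \<open>J\<close> maps injectively onto a linearly independent set of columns.\<close>

lemma card_independent_columns_le_rank:
  assumes A: "A \<in> carrier_mat n nc" and J: "J \<subseteq> {..<nc}"
    and ind: "independent_columns {..<n} J (\<lambda>i j. A $$ (i, j))"
  shows "card J \<le> rank A"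
proof -
  have fin: "finite J" using J finite_subset by blast
  have inj: "inj_on (col A) J"
  proof (rule inj_onI, rule ccontr)
    fix j k assume jk: "j \<in> J" "k \<in> J" "col A j = col A k" "j \<noteq> k"
    let ?c = "\<lambda>x. if x = j then 1 else if x = k then - 1 else 0"
    have "(\<Sum>x\<in>J. A $$ (i, x) * ?c x) = 0" if "i \<in> {..<n}" for i
    proof -
      have eq: "A $$ (i, j) = A $$ (i, k)"
      proof -
        have "j < nc" "k < nc" using J jk(1,2) by auto
        moreover have "col A j $ i = col A k $ i" using jk(3) by simp
        ultimately show ?thesis using A that by simp
      qed
      have "(\<Sum>x\<in>J. A $$ (i, x) * ?c x) = (\<Sum>x\<in>{j, k}. A $$ (i, x) * ?c x)"
        by (rule sum.mono_neutral_right) (use fin jk in auto)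
      also have "\<dots> = A $$ (i, j) - A $$ (i, k)"
        using jk(4) by simp
      also have "\<dots> = 0" using eq by simp
      finally show ?thesis .
    qed
    from independent_columnsD[OF ind, of ?c, OF this jk(1)] show False by simp
  qed
  have "lin_indpt (col A ` J)"
  proof (rule finite_lin_indpt2)
    show "finite (col A ` J)" using fin by simp
    show "col A ` J \<subseteq> carrier_vec n" using A by auto
    fix a assume "lincomb a (col A ` J) = 0\<^sub>v n"
    then have "(\<Sum>j\<in>J. A $$ (i, j) * a (col A j)) = 0" if "i \<in> {..<n}" for i
      using lincomb_cols[OF A J inj, of i a] that by simp
    from independent_columnsD[OF ind this]
    show "\<forall>v\<in>col A ` J. a v = 0" by auto
  qed
  then have "card (col A ` J) \<le> rank A"
    using J by (intro rank_ge_card_indpt[OF A]) (auto simp: set_cols_eq_image[OF A])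
  then show ?thesis by (simp add: card_image[OF inj])
qed

text \<open>A maximal independent set of columns has as many elements as the rank; one index is
  chosen for each of its vectors.\<close>

lemma obtain_rank_independent_columns:
  assumes A: "A \<in> carrier_mat n nc"
  obtains J where "J \<subseteq> {..<nc}" "card J = rank A" "independent_columns {..<n} J (\<lambda>i j. A $$ (i, j))"
proof -
  let ?P = "\<lambda>T. T \<subseteq> set (cols A) \<and> lin_indpt T"
  have "lin_indpt {}" by (rule finite_lin_indpt2) auto
  then have "?P {}" by simp
  then obtain S where max: "maximal S ?P"
    using maximal_exists_superset[of "set (cols A)" ?P "{}"] by auto
  then have S: "S \<subseteq> col A ` {..<nc}" "lin_indpt S"
    unfolding maximal_def set_cols_eq_image[OF A] by auto
  then obtain J where J: "J \<subseteq> {..<nc}" "inj_on (col A) J" "S = col A ` J"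
    by (auto simp: subset_image_inj)
  have fin: "finite J" using J(1) finite_subset by blast
  have "card J = rank A"
    using rank_card_indpt[OF A max] by (simp add: J(3) card_image[OF J(2)])
  moreover have "independent_columns {..<n} J (\<lambda>i j. A $$ (i, j))"
    unfolding independent_columns_def
  proof (intro allI impI ballI, rule ccontr)
    fix c j assume c: "\<forall>i\<in>{..<n}. (\<Sum>j\<in>J. A $$ (i, j) * c j) = 0" and j: "j \<in> J" "c j \<noteq> 0"
    \<comment> \<open>\<open>lincomb\<close> attaches coefficients to vectors, so \<open>c\<close>
      is moved from indices to columns by inverting \<open>col A\<close> on
      \<open>J\<close>.\<close>
    define a where "a x = c (the_inv_into J (col A) x)" for x
    have a: "a (col A j) = c j" if "j \<in> J" for j
      unfolding a_def by (simp add: the_inv_into_f_f[OF J(2) that])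
    have "lincomb a S = 0\<^sub>v n"
    proof (rule eq_vecI)
      have "S \<subseteq> carrier_vec n" using S(1) A by auto
      then show "dim_vec (lincomb a S) = dim_vec (0\<^sub>v n)"
        using lincomb_dim fin J(3) by simp
      fix i assume "i < dim_vec (0\<^sub>v n :: 'a vec)"
      then show "lincomb a S $ i = 0\<^sub>v n $ i"
        using c lincomb_cols[OF A J(1,2), of i a] by (simp add: J(3) a)
    qed
    then have "lin_dep S"
      by (intro lin_dep_crit[where A = S and a = a and v = "col A j"])
        (use fin j J(3) a[OF j(1)] in auto)
    with S(2) show False by blast
  qed
  ultimately show thesis using that J(1) by blast
qed

end

subsection \<open>Spanning trees\<close>

text \<open>A finite edge set is a forest iff each of its nonempty subsets has a vertex of degree one;
  this form provides leaves directly and excludes cycles without speaking about walks.\<close>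

definition forest_edges :: "'a set set \<Rightarrow> bool" where
  "forest_edges T \<longleftrightarrow> (\<forall>E'\<subseteq>T. E' \<noteq> {} \<longrightarrow> (\<exists>v. \<exists>!e. e \<in> E' \<and> v \<in> e))"

lemma forest_edgesD:
  assumes "forest_edges T" "E' \<subseteq> T" "E' \<noteq> {}"
  obtains v where "\<exists>!e. e \<in> E' \<and> v \<in> e"
  using assms(1)[unfolded forest_edges_def, rule_format, OF assms(2,3)] by (rule exE)

text \<open>Since \<open>w\<close> lies in no edge of \<open>T\<close>, it has degree one in every
  subset that contains the new edge.\<close>

lemma forest_edges_insert:
  assumes "forest_edges T" "w \<notin> \<Union>T"
  shows "forest_edges (insert {u, w} T)"
  unfolding forest_edges_def
proof (intro allI impI)
  fix E' assume E': "E' \<subseteq> insert {u, w} T" "E' \<noteq> {}"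
  show "\<exists>v. \<exists>!e. e \<in> E' \<and> v \<in> e"
  proof (cases "{u, w} \<in> E'")
    case True
    have "\<exists>!e. e \<in> E' \<and> w \<in> e"
      by (rule ex1I[of _ "{u, w}"]) (use True E'(1) assms(2) in auto)
    then show ?thesis by blast
  next
    case False
    then have "E' \<subseteq> T" using E'(1) by blast
    then show ?thesis using assms(1) E'(2) unfolding forest_edges_def by blast
  qed
qed

text \<open>The tree grows from \<open>r\<close>: while its vertex set is proper, \<open>cut\<close>
  supplies an edge to a new vertex.\<close>

lemma spanning_tree_exists:
  assumes fin: "finite V" and r: "r \<in> V"
    and cut: "\<And>W. W \<subset> V \<Longrightarrow> r \<in> W \<Longrightarrow> \<exists>u w. u \<in> W \<and> w \<in> V - W \<and> {u, w} \<in> E"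
  shows "\<exists>T\<subseteq>E. forest_edges T \<and> finite T \<and> Suc (card T) = card V"
proof -
  \<comment> \<open>The invariant \<open>\<Union>T \<subseteq> W\<close> keeps the next vertex
    outside all earlier edges, as \<open>forest_edges_insert\<close> requires.\<close>
  have "\<exists>W T. W \<subseteq> V \<and> r \<in> W \<and> card W = Suc k \<and> T \<subseteq> E \<and> \<Union>T \<subseteq> W \<and> forest_edges T
      \<and> finite T \<and> card T = k" if "k < card V" for k
    using that
  proof (induction k)
    case 0
    show ?case
      by (rule exI[of _ "{r}"], rule exI[of _ "{}"]) (use r in \<open>auto simp: forest_edges_def\<close>)
  next
    case (Suc k)
    then obtain W T where W: "W \<subseteq> V" "r \<in> W" "card W = Suc k"
      and T: "T \<subseteq> E" "\<Union>T \<subseteq> W" "forest_edges T" "finite T" "card T = k"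
      by auto
    have "W \<subset> V" using W(1,3) Suc.prems by auto
    with cut W(2) obtain u w where uw: "u \<in> W" "w \<in> V - W" "{u, w} \<in> E" by meson
    have w: "w \<notin> \<Union>T" using T(2) uw(2) by blast
    have "finite W" using W(1) fin finite_subset by blast
    moreover have "{u, w} \<notin> T" using w by blast
    ultimately show ?case
      using W T uw forest_edges_insert[OF T(3) w]
      by (intro exI[of _ "insert w W"] exI[of _ "insert {u, w} T"]) auto
  qed
  moreover have pos: "card V > 0" using fin r by (auto simp: card_gt_0_iff)
  then have "card V - 1 < card V" by simp
  ultimately obtain T where "T \<subseteq> E" "forest_edges T" "finite T" "card T = card V - 1" by meson
  with pos show ?thesis by (intro exI[of _ T]) auto
qed

subsection \<open>Matchings\<close>

text \<open>Each removal from \<open>S\<close> is paid by a matching edge (at most two vertices) or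
  by an edge of \<open>F\<close> (one vertex). Only edges of \<open>F\<close> of the form
  \<open>{v, f v}\<close> are counted, so one that is spent leaves the count.\<close>

lemma injection_card_le_matching:
  assumes "finite S" "inj_on f S" "\<And>v. v \<in> S \<Longrightarrow> {v, f v} \<in> E" "\<And>v. v \<in> S \<Longrightarrow> f v \<noteq> v"
    and "finite F" and forest: "forest_edges (E - F)"
  shows "\<exists>M\<subseteq>(\<lambda>v. {v, f v}) ` S. pairwise disjnt M
    \<and> card S \<le> 2 * card M + card (F \<inter> (\<lambda>v. {v, f v}) ` S)"
  using assms(1-4)
proof (induction S rule: finite_psubset_induct)
  case (psubset S)
  let ?e = "\<lambda>v. {v, f v}"
  have IH: "\<exists>M\<subseteq>?e ` S'. pairwise disjnt M \<and> card S' \<le> 2 * card M + card (F \<inter> ?e ` S')"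
    if "S' \<subset> S" for S'
    using that psubset.prems by (intro psubset.IH) (auto intro: inj_on_subset)
  show ?case
  \<comment> \<open>The condition says that \<open>v\<close> has no predecessor in \<open>S\<close>
    except possibly \<open>f v\<close>: it starts an \<open>f\<close>-path or lies on a
    2-cycle.\<close>
  proof (cases "\<exists>v\<in>S. \<forall>w\<in>S. w \<noteq> f v \<longrightarrow> f w \<noteq> v")
    case True
    then obtain v where v: "v \<in> S" "\<And>w. w \<in> S \<Longrightarrow> w \<noteq> f v \<Longrightarrow> f w \<noteq> v" by blast
    let ?S = "S - {v, f v}"
    have "?S \<subset> S" using v(1) by blast
    from IH[OF this] obtain M where M: "M \<subseteq> ?e ` ?S" "pairwise disjnt M"
      "card ?S \<le> 2 * card M + card (F \<inter> ?e ` ?S)" by blast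
    \<comment> \<open>For a remaining \<open>w\<close>, the value \<open>f w\<close> differs from
      \<open>v\<close> by the choice of \<open>v\<close> and from \<open>f v\<close> by
      injectivity.\<close>
    have dis: "?e w \<inter> ?e v = {}" if "w \<in> ?S" for w
      using v that psubset.prems(1) by (auto simp: inj_on_def)
    have "?e v \<notin> M" using M(1) dis by blast
    moreover have "finite M" using finite_subset[OF M(1)] psubset.hyps by simp
    ultimately have "card (insert (?e v) M) = Suc (card M)" by simp
    \<comment> \<open>Only an inequality, since \<open>f v\<close> may lie outside
      \<open>S\<close>.\<close>
    moreover have "card S \<le> card ?S + 2"
      using diff_card_le_card_Diff[of "{v, f v}" S] card_insert_le_m1[of 2 "{f v}" v]
      by (cases "v = f v") auto
    moreover have "card (F \<inter> ?e ` ?S) \<le> card (F \<inter> ?e ` S)"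
      using \<open>finite F\<close> by (intro card_mono) auto
    moreover have "pairwise disjnt (insert (?e v) M)"
    proof -
      have "disjnt m (?e v)" if "m \<in> M" for m
        using M(1) dis that unfolding disjnt_def by blast
      then show ?thesis
        using M(2) by (auto simp: pairwise_insert disjnt_sym)
    qed
    ultimately show ?thesis
      using M(1,3) v(1) by (intro exI[of _ "insert (?e v) M"]) auto
  next
    case False
    then have pre: "\<exists>w\<in>S. w \<noteq> f v \<and> f w = v" if "v \<in> S" for v using that by blast
    show ?thesis
    proof (cases "S = {}")
      case True
      then show ?thesis by (intro exI[of _ "{}"]) auto
    next
      case False
      have "S \<subseteq> f ` S" using pre by blast
      then have fS: "f ` S = S"
        using psubset.hyps card_image[OF psubset.prems(1)]
        by (metis card_subset_eq finite_imageI)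
      \<comment> \<open>Each \<open>x\<close> in \<open>S\<close> lies on two different edges, one
        to \<open>f x\<close> and one to its predecessor, so these edges cannot all belong to a
        forest.\<close>
      have no_leaf: "\<not> (\<exists>!e. e \<in> ?e ` S \<and> x \<in> e)" for x
      proof
        assume "\<exists>!e. e \<in> ?e ` S \<and> x \<in> e"
        then obtain e v where uniq: "\<And>e'. e' \<in> ?e ` S \<Longrightarrow> x \<in> e' \<Longrightarrow> e' = e"
          and "v \<in> S" "x \<in> {v, f v}" by (elim ex1E) blast
        then have x: "x \<in> S" using fS by blast
        then obtain w where w: "w \<in> S" "w \<noteq> f x" "f w = x" using pre by blast
        have "?e x = e" by (rule uniq) (use x in auto)
        moreover have "?e w = e" by (rule uniq) (use w in auto)
        moreover have "f x \<noteq> x" using psubset.prems(3) x .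
        ultimately show False using w(2,3) by (metis doubleton_eq_iff)
      qed
      have "\<not> ?e ` S \<subseteq> E - F"
      proof
        assume sub: "?e ` S \<subseteq> E - F"
        have "?e ` S \<noteq> {}" using False by simp
        then obtain x where "\<exists>!e. e \<in> ?e ` S \<and> x \<in> e"
          by (rule forest_edgesD[OF forest sub])
        then show False by (rule notE[OF no_leaf])
      qed
      then obtain v where v: "v \<in> S" "?e v \<in> F" using psubset.prems(2) by blast
      let ?S = "S - {v}"
      have "?S \<subset> S" using v(1) by blast
      from IH[OF this] obtain M where M: "M \<subseteq> ?e ` ?S" "pairwise disjnt M"
        "card ?S \<le> 2 * card M + card (F \<inter> ?e ` ?S)" by blast
      \<comment> \<open>Another vertex with the same edge would form a 2-cycle with
        \<open>v\<close>, which \<open>pre\<close> and injectivity exclude. Hence dropping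
        \<open>v\<close> really lowers the count of edges of \<open>F\<close>.\<close>
      have "?e v \<notin> ?e ` ?S"
      proof
        assume "?e v \<in> ?e ` ?S"
        then obtain w where w: "w \<in> S" "w \<noteq> v" "?e v = ?e w" by blast
        then have "w = f v" "f w = v" by (auto simp: doubleton_eq_iff)
        moreover obtain u where "u \<in> S" "u \<noteq> f v" "f u = v" using pre[OF v(1)] by blast
        ultimately show False using psubset.prems(1) w(1) by (auto simp: inj_on_def)
      qed
      then have "card (F \<inter> ?e ` ?S) < card (F \<inter> ?e ` S)"
        using \<open>finite F\<close> v by (intro psubset_card_mono) auto
      moreover have "card S = Suc (card ?S)"
        using psubset.hyps v(1) by (intro card.remove)
      ultimately show ?thesis
        using M by (intro exI[of _ M]) auto
    qed
  qed
qed

text \<open>Disjointness leaves at most one edge at \<open>u\<close>.\<close>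

lemma matching_delete_vertex:
  assumes "finite M" "pairwise disjnt M"
  shows "card M \<le> Suc (card {e \<in> M. u \<notin> e})"
proof -
  have "card {e \<in> M. u \<in> e} \<le> Suc 0"
    using assms unfolding pairwise_def disjnt_def by (auto simp: card_le_Suc0_iff_eq)
  moreover have "M = {e \<in> M. u \<notin> e} \<union> {e \<in> M. u \<in> e}" by blast
  then have "card M \<le> card {e \<in> M. u \<notin> e} + card {e \<in> M. u \<in> e}"
    by (metis card_Un_le)
  ultimately show ?thesis by simp
qed

text \<open>Vertices are deleted from \<open>W\<close>, each time at the cost of at most one
  matching edge. Deleting an end of an edge of \<open>F\<close> is paid by that edge; deleting a
  leaf with its neighbour is paid by two new columns.\<close>

lemma matching_le_independent_columns:
  fixes A :: "'a \<Rightarrow> 'a \<Rightarrow> 'k::field"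
  assumes supp: "\<And>x y. A x y \<noteq> 0 \<longleftrightarrow> {x, y} \<in> E"
    and E: "\<And>e. e \<in> E \<Longrightarrow> \<exists>u v. u \<noteq> v \<and> e = {u, v}"
    and F: "finite F" "forest_edges (E - F)"
    and "finite W" "finite M" "M \<subseteq> E" "\<Union>M \<subseteq> W" "pairwise disjnt M"
  shows "\<exists>J\<subseteq>W. independent_columns W J A \<and> 2 * card M \<le> card J + 2 * card {e \<in> F. e \<subseteq> W}"
  using assms(5-)
proof (induction W arbitrary: M rule: finite_psubset_induct)
  case (psubset W)
  consider (cycle) e where "e \<in> F" "e \<in> E" "e \<subseteq> W"
    | (empty) "M = {}"
    | (leaf) "{e \<in> E. e \<subseteq> W} \<subseteq> E - F" "M \<noteq> {}" by blast
  then show ?case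
  proof cases
    case cycle
    then obtain u where u: "u \<in> e" using E by blast
    let ?M = "{e \<in> M. u \<notin> e}" and ?W = "W - {u}"
    have "?W \<subset> W" using u cycle by blast
    moreover have "finite ?M" "?M \<subseteq> E" "\<Union>?M \<subseteq> ?W" "pairwise disjnt ?M"
      using psubset.prems by (auto simp: pairwise_def)
    ultimately obtain J where J: "J \<subseteq> ?W" "independent_columns ?W J A"
      "2 * card ?M \<le> card J + 2 * card {e \<in> F. e \<subseteq> ?W}"
      using psubset.IH[of ?W ?M] by blast
    have "card {e \<in> F. e \<subseteq> ?W} < card {e \<in> F. e \<subseteq> W}"
      using F(1) u cycle by (intro psubset_card_mono) auto
    moreover have "card M \<le> Suc (card ?M)"
      using psubset.prems by (intro matching_delete_vertex) auto
    moreover have "independent_columns W J A"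
      using J(2) by (rule independent_columns_mono) auto
    ultimately show ?thesis using J by (intro exI[of _ J]) auto
  next
    case empty
    then show ?thesis by (intro exI[of _ "{}"]) (auto simp: independent_columns_def)
  next
    case leaf
    \<comment> \<open>The edges inside \<open>W\<close> now form a nonempty subset of a forest,
      which yields the leaf \<open>v\<close>.\<close>
    have "{e \<in> E. e \<subseteq> W} \<noteq> {}" using leaf(2) psubset.prems by blast
    then obtain v where "\<exists>!e. e \<in> {e \<in> E. e \<subseteq> W} \<and> v \<in> e"
      by (rule forest_edgesD[OF F(2) leaf(1)])
    then obtain e where e: "e \<in> E" "e \<subseteq> W" "v \<in> e"
      and uniq: "\<And>e'. e' \<in> E \<Longrightarrow> e' \<subseteq> W \<Longrightarrow> v \<in> e' \<Longrightarrow> e' = e" by blast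
    obtain x y where "x \<noteq> y" "e = {x, y}" using E[OF e(1)] by blast
    then have "\<exists>u. u \<noteq> v \<and> e = {u, v}" using e(3) by (auto simp: doubleton_eq_iff)
    then obtain u where u: "u \<noteq> v" "e = {u, v}" by blast
    let ?M = "{e \<in> M. u \<notin> e}" and ?W = "W - {u, v}"
    have "?W \<subset> W" using u e by blast
    moreover have "finite ?M" "?M \<subseteq> E" "pairwise disjnt ?M"
      using psubset.prems by (auto simp: pairwise_def)
    moreover have "\<Union>?M \<subseteq> ?W"
    proof -
      have "v \<notin> e'" if "e' \<in> ?M" for e'
        using that uniq[of e'] psubset.prems u(2) by blast
      then show ?thesis using psubset.prems by blast
    qed
    ultimately obtain J where J: "J \<subseteq> ?W" "independent_columns ?W J A"
      "2 * card ?M \<le> card J + 2 * card {e \<in> F. e \<subseteq> ?W}"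
      using psubset.IH[of ?W ?M] by blast
    have finJ: "finite J" using J(1) psubset.hyps finite_subset by blast
    have uvJ: "u \<notin> J" "v \<notin> J" using J(1) by auto
    \<comment> \<open>Within \<open>W\<close> the leaf sees only \<open>u\<close>, so row
      \<open>v\<close> and column \<open>v\<close> vanish elsewhere, the diagonal entry
      included.\<close>
    have Av: "A v x = 0 \<and> A x v = 0" if "x \<in> W" "x \<noteq> u" for x
    proof -
      have "{v, x} \<notin> E"
      proof
        assume "{v, x} \<in> E"
        then have "{v, x} = {u, v}" using uniq[of "{v, x}"] that(1) e(2) u(2) by auto
        then show False using that(2) u(1) by (auto simp: doubleton_eq_iff)
      qed
      then show ?thesis using supp[of v x] supp[of x v] by (simp add: insert_commute)
    qed
    have Auv: "A u v \<noteq> 0" "A v u \<noteq> 0"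
      using supp e(1) u(2) by (auto simp: insert_commute)
    let ?J = "insert u (insert v J)"
    \<comment> \<open>Row \<open>v\<close> forces \<open>c u = 0\<close>; the rows of
      \<open>?W\<close> then involve only \<open>J\<close>; finally row \<open>u\<close> forces
      \<open>c v = 0\<close>.\<close>
    have "independent_columns W ?J A"
      unfolding independent_columns_def
    proof (intro allI impI)
      fix c assume c: "\<forall>i\<in>W. (\<Sum>j\<in>?J. A i j * c j) = 0"
      have row: "A i u * c u + A i v * c v + (\<Sum>j\<in>J. A i j * c j) = 0" if "i \<in> W" for i
        using bspec[OF c that] finJ uvJ u(1) by (simp add: add.assoc)
      have "(\<Sum>j\<in>J. A v j * c j) = 0"
        using Av J(1) by (intro sum.neutral) auto
      moreover have "A v v = 0" using Av e u by blast
      ultimately have cu: "c u = 0" using row[of v] Auv e u by auto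
      have "(\<Sum>j\<in>J. A i j * c j) = 0" if "i \<in> ?W" for i
        using row[of i] that cu Av[of i] by simp
      then have cJ: "c j = 0" if "j \<in> J" for j
        using independent_columnsD[OF J(2), of c] that by blast
      have "c v = 0" using row[of u] cu cJ Auv e u by auto
      then show "\<forall>j\<in>?J. c j = 0" using cu cJ by auto
    qed
    moreover have "card {e \<in> F. e \<subseteq> ?W} \<le> card {e \<in> F. e \<subseteq> W}"
      using F(1) by (intro card_mono) auto
    moreover have "card M \<le> Suc (card ?M)"
      using psubset.prems by (intro matching_delete_vertex) auto
    moreover have "card ?J = card J + 2" using finJ uvJ u(1) by simp
    ultimately show ?thesis
      using J(1,3) e(2) u(2) by (intro exI[of _ ?J]) auto
  qed
qed

subsection \<open>Connected graphs\<close>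

context pair_graph
begin

lemma finite_edges: "finite (edges G)"
  by (simp add: edges_def)

lemma doubleton_in_edges_iff: "{u, v} \<in> edges G \<longleftrightarrow> (u, v) \<in> parcs G"
  using pair_sym_arcs by (auto simp: edges_def doubleton_eq_iff symmetric_def intro: rev_image_eqI dest: symD)

lemma edge_eq_doubleton: "e \<in> edges G \<Longrightarrow> \<exists>u v. u \<noteq> v \<and> e = {u, v}"
  using pair_no_loops by (force simp: edges_def)

lemma edge_subset_pverts: "e \<in> edges G \<Longrightarrow> e \<subseteq> pverts G"
  using in_arcsD1 in_arcsD2 by (auto simp: edges_def)

lemma finite_matching: "is_matching G M \<Longrightarrow> finite M"
  unfolding is_matching_def using finite_edges finite_subset by blast

lemma finite_matchings: "finite {M. is_matching G M}"
  by (rule finite_subset[of _ "Pow (edges G)"]) (auto simp: is_matching_def finite_edges)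

lemma card_le_matching_number: "is_matching G M \<Longrightarrow> card M \<le> matching_number G"
  unfolding matching_number_def using finite_matchings by (intro Max_ge) auto

lemma obtain_maximum_matching:
  obtains M where "is_matching G M" "card M = matching_number G"
proof -
  have "is_matching G {}" by (simp add: is_matching_def)
  then have "matching_number G \<in> card ` {M. is_matching G M}"
    unfolding matching_number_def using finite_matchings by (intro Max_in) auto
  then show thesis using that by auto
qed

text \<open>Symmetry turns connected into strongly connected, so the whole graph is the only maximal
  strongly connected induced subgraph.\<close>

lemma num_components_connected:
  assumes "connected (with_proj G)"
  shows "num_components G = 1"
proof -
  have sc: "strongly_connected (with_proj G)"
    using assms sym_arcs by (intro symmetric_connected_imp_strongly_connected) auto
  have ind: "induced_subgraph (with_proj G) (with_proj G)"
    by (rule induced_subgraph_refl)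
  have "H = with_proj G" if H: "H \<in> sccs" for H
  proof -
    have "induced_subgraph H (with_proj G)" "\<not> verts H \<subset> verts (with_proj G)"
      using H sc ind unfolding sccs_def by blast+
    moreover from this have "verts H \<subseteq> verts (with_proj G)" by blast
    ultimately show ?thesis using ind by (intro induced_eq_verts_imp_eq) auto
  qed
  moreover have "with_proj G \<in> sccs"
    using sc ind unfolding sccs_def by (auto dest!: induced_imp_subgraph)
  ultimately have "sccs = {with_proj G}" by blast
  then show ?thesis by (simp add: num_components_def)
qed

text \<open>Serves to verify the hypothesis \<open>cut\<close> of
  \<open>spanning_tree_exists\<close>.\<close>

lemma reachable_imp_crossing_arc:
  assumes "u \<rightarrow>\<^sup>*\<^bsub>with_proj G\<^esub> v" "u \<in> W" "v \<notin> W"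
  shows "\<exists>x y. x \<in> W \<and> y \<notin> W \<and> (x, y) \<in> parcs G"
  using assms
proof (induction rule: reachable_induct)
  case base
  then show ?case by simp
next
  case (step x y)
  then show ?case by (cases "x \<in> W") auto
qed

text \<open>\<open>F\<close> is the complement of a spanning tree; with a single component, |E| -
  (|V| - 1) is the cyclomatic number.\<close>

lemma obtain_cycle_edges:
  assumes "connected (with_proj G)"
  obtains F where "finite F" "forest_edges (edges G - F)" "int (card F) = cyclomatic_number G"
proof -
  have sc: "strongly_connected (with_proj G)"
    using assms sym_arcs by (intro symmetric_connected_imp_strongly_connected) auto
  then obtain r where r: "r \<in> pverts G" by (auto simp: strongly_connected_def)
  have "\<exists>u w. u \<in> W \<and> w \<in> pverts G - W \<and> {u, w} \<in> edges G" if "W \<subset> pverts G" "r \<in> W" for W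
  proof -
    obtain v where v: "v \<in> pverts G" "v \<notin> W" using \<open>W \<subset> pverts G\<close> by blast
    have "r \<rightarrow>\<^sup>*\<^bsub>with_proj G\<^esub> v"
      using sc r v(1) by (auto simp: strongly_connected_def)
    then obtain x y where "x \<in> W" "y \<notin> W" "(x, y) \<in> parcs G"
      using reachable_imp_crossing_arc \<open>r \<in> W\<close> v(2) by blast
    then show ?thesis using in_arcsD2 doubleton_in_edges_iff by blast
  qed
  then obtain T where T: "T \<subseteq> edges G" "forest_edges T" "finite T" "Suc (card T) = card (pverts G)"
    using spanning_tree_exists[OF pair_finite_verts r, of "edges G"] by blast
  show thesis
  proof
    show "finite (edges G - T)" using finite_edges by simp
    show "forest_edges (edges G - (edges G - T))"
      using T(1,2) by (simp add: double_diff)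
    have "card T \<le> card (edges G)" using T(1) finite_edges card_mono by blast
    then show "int (card (edges G - T)) = cyclomatic_number G"
      using T num_components_connected[OF assms]
      by (simp add: cyclomatic_number_def card_Diff_subset)
  qed
qed

end

section \<open>The two bounds for gain graphs\<close>

context complex_unit_gain_graph
begin

text \<open>The adjacency matrix indexed by vertices instead of list positions, the form in which
  the combinatorial lemmas apply.\<close>

definition gain_entry :: "'a \<Rightarrow> 'a \<Rightarrow> complex" where
  "gain_entry x y = (if (x, y) \<in> parcs G then \<phi> (x, y) else 0)"

text \<open>Gains have modulus one and so never vanish: the zero pattern is that of the
  graph.\<close>

lemma gain_entry_nonzero: "gain_entry x y \<noteq> 0 \<longleftrightarrow> {x, y} \<in> edges G"
proof -
  have "\<phi> (x, y) \<noteq> 0" if "(x, y) \<in> parcs G"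
    using gain_unit[OF that] by (auto simp: unit_complex_def)
  then show ?thesis
    unfolding gain_entry_def doubleton_in_edges_iff by simp
qed

lemma independent_columns_gain_adjacency_matrix:
  assumes "distinct vs" "J \<subseteq> {..<length vs}"
  shows "independent_columns {..<length vs} J (\<lambda>i j. gain_adjacency_matrix G \<phi> vs $$ (i, j))
    \<longleftrightarrow> independent_columns (set vs) ((!) vs ` J) gain_entry"
proof -
  have "(\<Sum>j\<in>J. gain_adjacency_matrix G \<phi> vs $$ (i, j) * c j)
      = (\<Sum>j\<in>J. gain_entry (vs ! i) (vs ! j) * c j)" if "i < length vs" for i c
    using assms(2) that
    by (intro sum.cong) (auto simp: gain_adjacency_matrix_def gain_entry_def subset_iff)
  then have "independent_columns {..<length vs} J (\<lambda>i j. gain_adjacency_matrix G \<phi> vs $$ (i, j))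
    \<longleftrightarrow> independent_columns {..<length vs} J (\<lambda>i j. gain_entry (vs ! i) (vs ! j))"
    unfolding independent_columns_def by simp
  also have "\<dots> \<longleftrightarrow> independent_columns (set vs) ((!) vs ` J) gain_entry"
    using assms by (intro independent_columns_reindex)
      (auto simp: bij_betw_nth inj_on_def nth_eq_iff_index_eq subset_iff)
  finally show ?thesis .
qed

text \<open>A set of independent columns as large as the rank is a vertex set \<open>S\<close>. The
  injection into rows sends each vertex of \<open>S\<close> to a neighbour, from which a matching is
  extracted.\<close>

lemma gain_rank_le_matching:
  assumes "distinct vs" "set vs = pverts G" and F: "finite F" "forest_edges (edges G - F)"
  shows "gain_rank G \<phi> vs \<le> 2 * matching_number G + card F"
proof -
  obtain J where J: "J \<subseteq> {..<length vs}" "card J = gain_rank G \<phi> vs"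
    "independent_columns {..<length vs} J (\<lambda>i j. gain_adjacency_matrix G \<phi> vs $$ (i, j))"
    using vec_space.obtain_rank_independent_columns[of "gain_adjacency_matrix G \<phi> vs" "length vs" "length vs"]
    unfolding gain_rank_def by (auto simp: gain_adjacency_matrix_def)
  define S where "S = (!) vs ` J"
  have S: "independent_columns (pverts G) S gain_entry"
    using independent_columns_gain_adjacency_matrix[OF assms(1) J(1)] J(3) assms(2)
    by (simp add: S_def)
  have "inj_on ((!) vs) J"
    using J(1) assms(1) by (auto simp: inj_on_def nth_eq_iff_index_eq subset_iff)
  then have card: "card S = gain_rank G \<phi> vs"
    using J(2) by (simp add: S_def card_image)
  have fin: "finite S" using J(1) finite_subset by (auto simp: S_def)
  from independent_columns_imp_injection[OF pair_finite_verts fin S]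
  obtain f where f: "inj_on f S" "\<And>v. v \<in> S \<Longrightarrow> gain_entry (f v) v \<noteq> 0" by blast
  have fe: "{v, f v} \<in> edges G" if "v \<in> S" for v
    using f(2)[OF that] gain_entry_nonzero by (simp add: insert_commute)
  then have "f v \<noteq> v" if "v \<in> S" for v
    using that edge_eq_doubleton[of "{v, f v}"] by auto
  from injection_card_le_matching[OF fin f(1) fe this F]
  obtain M where M: "M \<subseteq> (\<lambda>v. {v, f v}) ` S" "pairwise disjnt M"
    "card S \<le> 2 * card M + card (F \<inter> (\<lambda>v. {v, f v}) ` S)" by blast
  have "is_matching G M" using M(1,2) fe by (auto simp: is_matching_def)
  then have "card M \<le> matching_number G" by (rule card_le_matching_number)
  moreover have "card (F \<inter> (\<lambda>v. {v, f v}) ` S) \<le> card F"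
    using F(1) by (intro card_mono) auto
  ultimately show ?thesis using M(3) card by linarith
qed

text \<open>A maximum matching, with \<open>W\<close> the set of all vertices, yields independent
  columns indexed by vertices; these are pulled back to matrix positions.\<close>

lemma matching_le_gain_rank:
  assumes "distinct vs" "set vs = pverts G" and F: "finite F" "forest_edges (edges G - F)"
  shows "2 * matching_number G \<le> gain_rank G \<phi> vs + 2 * card F"
proof -
  obtain M where M: "is_matching G M" "card M = matching_number G"
    by (rule obtain_maximum_matching)
  have "\<Union>M \<subseteq> pverts G" using M(1) edge_subset_pverts by (auto simp: is_matching_def)
  then obtain S where S: "S \<subseteq> set vs" "independent_columns (set vs) S gain_entry"
    "2 * card M \<le> card S + 2 * card {e \<in> F. e \<subseteq> set vs}"
    using matching_le_independent_columns[of gain_entry "edges G" F "set vs" M]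
      gain_entry_nonzero edge_eq_doubleton F M(1) finite_matching[OF M(1)] assms(2)
    by (auto simp: is_matching_def)
  have "S \<subseteq> (!) vs ` {..<length vs}"
    using S(1) by (auto simp: subset_iff in_set_conv_nth)
  then obtain J where J: "J \<subseteq> {..<length vs}" "S = (!) vs ` J" "inj_on ((!) vs) J"
    by (auto simp: subset_image_inj)
  have "card J \<le> gain_rank G \<phi> vs"
    unfolding gain_rank_def
  proof (rule vec_space.card_independent_columns_le_rank[OF _ J(1)])
    show "independent_columns {..<length vs} J (\<lambda>i j. gain_adjacency_matrix G \<phi> vs $$ (i, j))"
      using independent_columns_gain_adjacency_matrix[OF assms(1) J(1)] S(2) J(2) by simp
  qed (simp add: gain_adjacency_matrix_def)
  moreover have "card {e \<in> F. e \<subseteq> set vs} \<le> card F"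
    using F(1) by (intro card_mono) auto
  moreover have "card S = card J" using J(2,3) by (simp add: card_image)
  ultimately show ?thesis using S(3) M(2) by linarith
qed

end

theorem theorem1p10:
  fixes G :: "'a pair_pre_digraph"
    and \<phi> :: "'a \<times> 'a \<Rightarrow> complex"
    and vs :: "'a list"
  assumes "complex_unit_gain_graph G \<phi>"
    and "Digraph_Component.connected (with_proj G)"
    and "distinct vs" and "set vs = pverts G"
  shows "2 * int (matching_number G) - 2 * cyclomatic_number G \<le> int (gain_rank G \<phi> vs)
       \<and> int (gain_rank G \<phi> vs) \<le> 2 * int (matching_number G) + cyclomatic_number G"
proof -
  interpret complex_unit_gain_graph G \<phi> by fact
  obtain F where F: "finite F" "forest_edges (edges G - F)" "int (card F) = cyclomatic_number G"
    by (rule obtain_cycle_edges[OF assms(2)])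
  show ?thesis
    using gain_rank_le_matching[OF assms(3,4) F(1,2)] matching_le_gain_rank[OF assms(3,4) F(1,2)]
    unfolding F(3)[symmetric] by linarith
qed

end
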